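(* Let $K$ be a finite collection of closed, convex Vergili ribbon complexes $\mathrm{rbx}\,K$ in Euclidean space. Then the nerve of the collection $K$ (whose simplices are the nonempty subcollections of $K$ with nonempty common intersection) and the union of the Vergili ribbon complexes in $K$ have the same homotopy type.
   Context: A filled cycle $\mathrm{cyc}\,A$ is the part of the plane consisting of a simple closed curve (containing a finite, nonempty, path-connected collection of vertices of a planar CW space) together with everything inside it; $\mathrm{cl}$, $\mathrm{int}$ denote closure and interior. Given filled cycles $\mathrm{cyc}\,A,\mathrm{cyc}\,B$ with $\mathrm{cyc}\,B$ contained entirely in the interior of $\mathrm{cyc}\,A$, the associated planar ribbon is $\mathrm{cl}(\mathrm{cyc}\,A)\setminus\mathrm{int}(\mathrm{cyc}\,B)$. A Vergili ribbon complex is a nonempty countable collection of planar ribbons; as a subset of Euclidean space it is identified with the union of its ribbons, and it is called closed, convex if that subset is. For a finite nonempty collection $F$ of sets, $\mathrm{Nrv}\,F=\{X\subseteq F: X\neq\emptyset,\ \bigcap X\neq\emptyset\}$, regarded as an abstract simplicial complex; its homotopy type is that of its geometric realization. *)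

theory Defs
  imports "HOL-Analysis.Analysis"
begin

type_synonym plane = "real^2"

text \<open>
  A CW decomposition of \<open>X\<close> is given by the sets \<open>E n\<close> of open \<open>n\<close>-cells. The model
  \<open>n\<close>-disc is the unit ball of an \<open>n\<close>-dimensional linear subspace \<open>V\<close> of the ambient space;
  cells of larger dimension cannot occur, by invariance of domain. As characteristic maps have
  compact domain, the closed cell belonging to \<open>e\<close> is \<open>closure e\<close>. Hausdorffness is automatic.
\<close>

definition is_cell ::
    "(nat \<Rightarrow> 'a::euclidean_space set set) \<Rightarrow> nat \<Rightarrow> 'a set \<Rightarrow> bool" where
  "is_cell E n e \<longleftrightarrow>
     (\<exists>(V :: 'a set) \<Phi> \<Psi>. subspace V \<and> dim V = n \<and>
        continuous_on (cball 0 1 \<inter> V) \<Phi> \<and>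
        homeomorphism (ball 0 1 \<inter> V) e \<Phi> \<Psi> \<and>
        (\<exists>\<F>. finite \<F> \<and> \<F> \<subseteq> (\<Union>m<n. E m) \<and> \<Phi> ` (sphere 0 1 \<inter> V) \<subseteq> \<Union>\<F>))"

definition cw_space ::
    "'a::euclidean_space set \<Rightarrow> (nat \<Rightarrow> 'a set set) \<Rightarrow> bool" where
  "cw_space X E \<longleftrightarrow>
     X = (\<Union>n. \<Union>(E n)) \<and>
     (\<forall>m n. \<forall>d\<in>E m. \<forall>e\<in>E n. (m, d) \<noteq> (n, e) \<longrightarrow> d \<inter> e = {}) \<and>
     (\<forall>n. \<forall>e\<in>E n. is_cell E n e) \<and>
     (\<forall>C\<subseteq>X. closedin (top_of_set X) C \<longleftrightarrow>
        (\<forall>n. \<forall>e\<in>E n. closedin (top_of_set (closure e)) (C \<inter> closure e)))"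

definition vertices :: "(nat \<Rightarrow> 'a set set) \<Rightarrow> 'a set" where
  "vertices E = \<Union>(E 0)"

definition vertex_collection :: "plane set \<Rightarrow> bool" where
  "vertex_collection A \<longleftrightarrow> finite A \<and> A \<noteq> {} \<and>
     (\<exists>X E. cw_space X E \<and> A \<subseteq> vertices E \<and> (\<forall>u\<in>A. \<forall>v\<in>A. path_component X u v))"

definition filled_cycle :: "plane set \<Rightarrow> plane set \<Rightarrow> bool" where
  "filled_cycle A C \<longleftrightarrow> vertex_collection A \<and>
     (\<exists>g. simple_path g \<and> pathfinish g = pathstart g \<and> A \<subseteq> path_image g \<and>
        C = path_image g \<union> inside (path_image g))"

definition planar_ribbon :: "plane set \<Rightarrow> bool" where
  "planar_ribbon R \<longleftrightarrow>
     (\<exists>A B cycA cycB. filled_cycle A cycA \<and> filled_cycle B cycB \<and>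
        cycB \<subseteq> interior cycA \<and> R = closure cycA - interior cycB)"

definition vergili_ribbon_complex :: "plane set set \<Rightarrow> bool" where
  "vergili_ribbon_complex \<R> \<longleftrightarrow>
     \<R> \<noteq> {} \<and> countable \<R> \<and> (\<forall>R\<in>\<R>. planar_ribbon R)"

text \<open>
  The vertices of the nerve are the members of the collection \<open>K\<close>; the function \<open>pts\<close> assigns
  to each of them the point set it is identified with.
\<close>

definition nerve :: "('v \<Rightarrow> 'a set) \<Rightarrow> 'v set \<Rightarrow> 'v set set" where
  "nerve pts K = {X. X \<subseteq> K \<and> X \<noteq> {} \<and> (\<Inter>v\<in>X. pts v) \<noteq> {}}"

text \<open>
  Realization by barycentric coordinates, as a subspace of the function type with its product
  topology. For complexes with finitely many vertices, this is the usual topology; for infinite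
  ones the coherent topology may be finer.
\<close>

definition geometric_realization :: "'v set set \<Rightarrow> ('v \<Rightarrow> real) set" where
  "geometric_realization \<Delta> =
     {x. (\<forall>v. 0 \<le> x v) \<and> {v. x v \<noteq> 0} \<in> \<Delta> \<and> (\<Sum>v | x v \<noteq> 0. x v) = 1}"

end

theory Submission
  imports Defs
begin

text \<open>
  Let \<open>d\<^sub>v\<close> be the distance to the closed convex set \<open>A v\<close>. A non-simplex \<open>X\<close> has
  \<open>\<Sum>v\<in>X. d\<^sub>v > 0\<close> everywhere, so there is a continuous \<open>\<epsilon> > 0\<close> such that
  \<open>{v. d\<^sub>v u < \<epsilon> u}\<close> is a simplex for each \<open>u\<close> in the union; normalizing
  \<open>max 0 (\<epsilon> - d\<^sub>v)\<close> gives a map \<open>f\<close> from the union to the realization. In the other direction,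
  choose \<open>p X \<in> \<Inter>(A ` X)\<close> for each simplex \<open>X\<close>, and a threshold \<open>c < 1 / card K\<close>. Let \<open>g x\<close> be
  a weighted mean of those \<open>p X\<close> for which \<open>X\<close> contains every \<open>v\<close> with \<open>x v \<ge> c\<close>, so that
  \<open>g x \<in> A v\<close> for all such \<open>v\<close>.

  The coordinates of \<open>f u\<close> are largest where \<open>d\<^sub>v u = 0\<close>, so \<open>u\<close> and \<open>g (f u)\<close> lie in a common
  \<open>A v\<close>. The map \<open>\<rho>\<close> normalizing \<open>max 0 (x v - c)\<close> has \<open>\<rho> x\<close> in a common simplex with \<open>x\<close>, and
  also with \<open>f (g x)\<close>. All homotopies are therefore straight lines.
\<close>

section \<open>Realizations of finite nerves\<close>

lemma nerve_subset:
  assumes "X \<in> nerve A K" "Y \<subseteq> X" "Y \<noteq> {}"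
  shows "Y \<in> nerve A K"
  using assms unfolding nerve_def by blast

text \<open>The support lies in \<open>K\<close>, so the sum can run over this fixed finite set
  instead of the varying support. This makes it additive in \<open>x\<close> and continuous.\<close>

lemma geometric_realization_nerve_iff:
  assumes "finite K"
  shows "x \<in> geometric_realization (nerve A K) \<longleftrightarrow>
    (\<forall>v. 0 \<le> x v) \<and> {v. x v \<noteq> 0} \<in> nerve A K \<and> sum x K = 1"
proof -
  have "(\<Sum>v | x v \<noteq> 0. x v) = sum x K" if "{v. x v \<noteq> 0} \<in> nerve A K"
    using that assms unfolding nerve_def by (intro sum.mono_neutral_left) auto
  then show ?thesis
    unfolding geometric_realization_def by auto
qed

lemma normalize_in_geometric_realization:
  assumes K: "finite K" and nonneg: "\<And>v. 0 \<le> h v"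
    and X: "{v. h v \<noteq> 0} \<in> nerve A K"
  shows "(\<lambda>v. h v / sum h K) \<in> geometric_realization (nerve A K)"
    and "{v. h v / sum h K \<noteq> 0} = {v. h v \<noteq> 0}"
proof -
  obtain w where "w \<in> K" "h w \<noteq> 0"
    using X unfolding nerve_def by auto
  then have "h w > 0" using nonneg[of w] by simp
  then have pos: "sum h K > 0"
    using K nonneg \<open>w \<in> K\<close> by (intro sum_pos2[of _ w]) auto
  then show supp: "{v. h v / sum h K \<noteq> 0} = {v. h v \<noteq> 0}"
    by auto
  show "(\<lambda>v. h v / sum h K) \<in> geometric_realization (nerve A K)"
    unfolding geometric_realization_nerve_iff[OF K] supp
    using pos X nonneg by (simp add: sum_divide_distrib[symmetric])
qed

text \<open>The straight line works: along it the coordinate sum stays 1, so the support stays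
  nonempty, and it lies in the union of the two end supports, a simplex by
  \<open>common\<close>.\<close>

lemma homotopic_into_geometric_realization:
  fixes F G :: "'b::topological_space \<Rightarrow> 'v \<Rightarrow> real"
  assumes K: "finite K" and F: "continuous_on S F" and G: "continuous_on S G"
    and FR: "F ` S \<subseteq> geometric_realization (nerve A K)"
    and GR: "G ` S \<subseteq> geometric_realization (nerve A K)"
    and common: "\<And>s. s \<in> S \<Longrightarrow> {v. F s v \<noteq> 0} \<union> {v. G s v \<noteq> 0} \<in> nerve A K"
  shows "homotopic_with_canon (\<lambda>_. True) S (geometric_realization (nerve A K)) F G"
proof -
  define h where "h = (\<lambda>(t::real, s) v. (1 - t) * F s v + t * G s v)"
  have Fv: "continuous_on S (\<lambda>s. F s v)" and Gv: "continuous_on S (\<lambda>s. G s v)" for v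
    by (rule continuous_on_product_then_coordinatewise[OF F]
      continuous_on_product_then_coordinatewise[OF G])+
  have "continuous_on ({0..1} \<times> S) (\<lambda>z. h z v)" for v
    unfolding h_def case_prod_unfold
    by (intro continuous_intros continuous_on_compose2[OF Fv] continuous_on_compose2[OF Gv]) auto
  then have cont: "continuous_on ({0..1} \<times> S) h"
    by (rule continuous_on_coordinatewise_then_product)
  have "h (t, s) \<in> geometric_realization (nerve A K)" if t: "t \<in> {0..1}" and s: "s \<in> S" for t s
  proof -
    have x: "\<forall>v. 0 \<le> F s v" "sum (F s) K = 1" and y: "\<forall>v. 0 \<le> G s v" "sum (G s) K = 1"
      using FR GR s geometric_realization_nerve_iff[OF K] by blast+
    have nonneg: "\<forall>v. 0 \<le> h (t, s) v"
      using x y t by (simp add: h_def)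
    have "sum (h (t, s)) K = (1 - t) * sum (F s) K + t * sum (G s) K"
      by (simp add: h_def sum.distrib sum_distrib_left)
    then have one: "sum (h (t, s)) K = 1"
      using x y by simp
    have "{v. h (t, s) v \<noteq> 0} \<noteq> {}"
    proof
      assume "{v. h (t, s) v \<noteq> 0} = {}"
      then have "sum (h (t, s)) K = 0" by simp
      with one show False by simp
    qed
    moreover have "{v. h (t, s) v \<noteq> 0} \<subseteq> {v. F s v \<noteq> 0} \<union> {v. G s v \<noteq> 0}"
      by (auto simp: h_def)
    ultimately have "{v. h (t, s) v \<noteq> 0} \<in> nerve A K"
      using nerve_subset[OF common[OF s]] by blast
    with nonneg one show ?thesis
      using geometric_realization_nerve_iff[OF K] by blast
  qed
  with cont have "continuous_map (top_of_set ({0..1} \<times> S))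
      (top_of_set (geometric_realization (nerve A K))) h"
    by auto
  then show ?thesis
    unfolding homotopic_with_def
    by (intro exI[of _ h]) (auto simp: h_def prod_topology_subtopology_eu)
qed

text \<open>Pigeonhole on coordinates with sum 1. The \<open>+ 1\<close> in the denominator makes
  the inequality strict, so subtracting this threshold leaves a positive coordinate.\<close>

lemma geometric_realization_coordinate_gt:
  assumes K: "finite K" and x: "x \<in> geometric_realization (nerve A K)"
  obtains v where "v \<in> K" "x v > 1 / (real (card K) + 1)"
proof (rule ccontr)
  assume "\<not> thesis"
  then have "\<forall>v\<in>K. x v \<le> 1 / (real (card K) + 1)"
    using that by force
  then have "sum x K \<le> real (card K) * (1 / (real (card K) + 1))"
    by (intro sum_bounded_above) auto
  also have "\<dots> < 1" by simp
  finally show False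
    using x geometric_realization_nerve_iff[OF K] by (metis less_irrefl)
qed

section \<open>The nerve theorem for finite closed convex covers\<close>

text \<open>Every \<open>u\<close> misses some member of a non-simplex, and closedness turns this
  into a positive distance. A product over the finitely many non-simplices keeps positivity and
  continuity; it is 1 if there are none.\<close>

lemma nerve_distance_bound:
  fixes A :: "'v \<Rightarrow> 'a::metric_space set"
  assumes K: "finite K" and closed: "\<And>v. v \<in> K \<Longrightarrow> closed (A v)"
    and ne: "\<And>v. v \<in> K \<Longrightarrow> A v \<noteq> {}"
  obtains \<epsilon> :: "'a \<Rightarrow> real" where "continuous_on UNIV \<epsilon>" "\<And>u. \<epsilon> u > 0"
    "\<And>u X. X \<subseteq> K \<Longrightarrow> X \<noteq> {} \<Longrightarrow> (\<And>v. v \<in> X \<Longrightarrow> infdist u (A v) < \<epsilon> u) \<Longrightarrow> X \<in> nerve A K"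
proof -
  \<comment> \<open>The mean lies strictly below any strict upper bound of the distances. The cap at
    1 makes the product of all \<open>\<delta> X u\<close> at most each single factor.\<close>
  define \<delta> where "\<delta> X u = min 1 ((\<Sum>v\<in>X. infdist u (A v)) / card X)" for X u
  define N where "N = {X. X \<subseteq> K \<and> X \<noteq> {} \<and> X \<notin> nerve A K}"
  define \<epsilon> where "\<epsilon> u = (\<Prod>X\<in>N. \<delta> X u)" for u
  have finN: "finite N"
    using K unfolding N_def by (auto intro: finite_subset[of _ "Pow K"])
  have \<delta>_pos: "\<delta> X u > 0" if "X \<in> N" for X u
  proof -
    have X: "X \<subseteq> K" "X \<noteq> {}" "(\<Inter>v\<in>X. A v) = {}" "finite X"
      using that K finite_subset unfolding N_def nerve_def by auto
    then obtain v where "v \<in> X" "u \<notin> A v" by blast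
    then have "infdist u (A v) > 0"
      using X closed ne infdist_pos_not_in_closed by (metis subsetD)
    then have "(\<Sum>v\<in>X. infdist u (A v)) > 0"
      using X \<open>v \<in> X\<close> by (intro sum_pos2[of _ v]) (auto simp: infdist_nonneg)
    with X show ?thesis
      by (simp add: \<delta>_def card_gt_0_iff)
  qed
  show thesis
  proof (rule that)
    show "continuous_on UNIV \<epsilon>"
      unfolding \<epsilon>_def \<delta>_def divide_inverse by (intro continuous_intros)
    show "\<epsilon> u > 0" for u
      unfolding \<epsilon>_def using \<delta>_pos by (intro prod_pos) auto
    fix u X
    assume X: "X \<subseteq> K" "X \<noteq> {}" and near: "\<And>v. v \<in> X \<Longrightarrow> infdist u (A v) < \<epsilon> u"
    show "X \<in> nerve A K"
    proof (rule ccontr)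
      assume "X \<notin> nerve A K"
      with X have XN: "X \<in> N" unfolding N_def by blast
      have "\<epsilon> u = \<delta> X u * (\<Prod>Y\<in>N - {X}. \<delta> Y u)"
        unfolding \<epsilon>_def using finN XN by (rule prod.remove)
      also have "\<dots> \<le> \<delta> X u"
        using \<delta>_pos XN
        by (intro mult_left_le prod_le_1) (auto simp: \<delta>_def intro: less_imp_le)
      also have "\<dots> \<le> (\<Sum>v\<in>X. infdist u (A v)) / card X"
        by (simp add: \<delta>_def)
      also have "\<dots> < \<epsilon> u"
      proof -
        have "finite X" using X K finite_subset by blast
        then have "(\<Sum>v\<in>X. infdist u (A v)) < (\<Sum>v\<in>X. \<epsilon> u)"
          using X near by (intro sum_strict_mono) auto
        then show ?thesis
          using \<open>finite X\<close> X by (simp add: divide_simps card_gt_0_iff mult.commute)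
      qed
      finally show False by simp
    qed
  qed
qed

text \<open>The unnormalized coordinate at \<open>v\<close> attains its greatest possible value
  \<open>\<epsilon> u\<close> exactly where the distance is 0. The last conclusion later moves a
  large coordinate of \<open>f u\<close> to a member that contains \<open>u\<close>.\<close>

lemma nerve_map_from_union:
  fixes A :: "'v \<Rightarrow> 'a::metric_space set"
  assumes K: "finite K" and closed: "\<And>v. v \<in> K \<Longrightarrow> closed (A v)"
    and ne: "\<And>v. v \<in> K \<Longrightarrow> A v \<noteq> {}"
  obtains f :: "'a \<Rightarrow> 'v \<Rightarrow> real" where
    "continuous_on (\<Union>v\<in>K. A v) f"
    "f ` (\<Union>v\<in>K. A v) \<subseteq> geometric_realization (nerve A K)"
    "\<And>u v. v \<in> K \<Longrightarrow> u \<in> A v \<Longrightarrow> f u v \<noteq> 0"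
    "\<And>u v w. v \<in> K \<Longrightarrow> u \<in> A v \<Longrightarrow> f u w \<le> f u v"
proof -
  obtain \<epsilon> :: "'a \<Rightarrow> real" where cont: "continuous_on UNIV \<epsilon>" and pos: "\<And>u. \<epsilon> u > 0"
    and simplex: "\<And>u X. X \<subseteq> K \<Longrightarrow> X \<noteq> {} \<Longrightarrow>
      (\<And>v. v \<in> X \<Longrightarrow> infdist u (A v) < \<epsilon> u) \<Longrightarrow> X \<in> nerve A K"
    using assms by (rule nerve_distance_bound[of K A]) (blast intro: that)+
  define h where "h u v = (if v \<in> K then max 0 (\<epsilon> u - infdist u (A v)) else 0)" for u v
  define f where "f u v = h u v / sum (h u) K" for u v
  have nonneg: "0 \<le> h u v" for u v by (simp add: h_def)
  have at: "h u v = \<epsilon> u" if "v \<in> K" "u \<in> A v" for u v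
    using that pos[of u] by (simp add: h_def)
  have supp: "{v. h u v \<noteq> 0} \<in> nerve A K" if u: "u \<in> (\<Union>v\<in>K. A v)" for u
  proof (rule simplex[of _ u])
    obtain v where "v \<in> K" "u \<in> A v" using u by blast
    then have "h u v \<noteq> 0" using at pos[of u] by simp
    then show "{v. h u v \<noteq> 0} \<noteq> {}" by blast
  qed (auto simp: h_def max_def split: if_splits)
  note norm = normalize_in_geometric_realization[OF K nonneg supp, folded f_def]
  have sum_pos: "sum (h u) K > 0" if u: "u \<in> (\<Union>v\<in>K. A v)" for u
  proof -
    obtain v where "v \<in> K" "u \<in> A v" using u by blast
    then show ?thesis
      using K nonneg at pos by (intro sum_pos2[of _ v]) auto
  qed
  have hcont: "continuous_on S (\<lambda>u. h u v)" for v S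
    unfolding h_def
    by (cases "v \<in> K") (simp_all, intro continuous_intros continuous_on_subset[OF cont subset_UNIV])
  show thesis
  proof (rule that)
    have "continuous_on (\<Union>v\<in>K. A v) (\<lambda>u. f u v)" for v
      unfolding f_def using sum_pos
      by (intro continuous_intros hcont) (auto simp: less_imp_neq[symmetric])
    then show "continuous_on (\<Union>v\<in>K. A v) f"
      by (rule continuous_on_coordinatewise_then_product)
    show "f ` (\<Union>v\<in>K. A v) \<subseteq> geometric_realization (nerve A K)"
      using norm(1) unfolding f_def by blast
    fix u v assume v: "v \<in> K" "u \<in> A v"
    then have s: "sum (h u) K > 0" using sum_pos by blast
    show "f u v \<noteq> 0"
      using at[OF v] pos[of u] s by (simp add: f_def)
    have "h u w \<le> h u v" for w
      using at[OF v] pos[of u] infdist_nonneg[of u "A w"] by (simp add: h_def)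
    then show "f u w \<le> f u v" for w
      using s by (simp add: f_def divide_right_mono)
  qed
qed

lemma nerve_map_to_union:
  fixes A :: "'v \<Rightarrow> 'a::real_normed_vector set"
  assumes K: "finite K" and convex: "\<And>v. v \<in> K \<Longrightarrow> convex (A v)" and c: "c > 0"
  obtains g :: "('v \<Rightarrow> real) \<Rightarrow> 'a" where
    "continuous_on (geometric_realization (nerve A K)) g"
    "\<And>x v. x \<in> geometric_realization (nerve A K) \<Longrightarrow> v \<in> K \<Longrightarrow> x v \<ge> c \<Longrightarrow> g x \<in> A v"
proof -
  let ?R = "geometric_realization (nerve A K)" and ?N = "nerve A K"
  have finN: "finite ?N"
    using K unfolding nerve_def by (auto intro: finite_subset[of _ "Pow K"])
  have "\<exists>p. \<forall>X\<in>?N. p X \<in> (\<Inter>v\<in>X. A v)"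
    unfolding nerve_def by (intro bchoice) auto
  then obtain p where p: "\<And>X v. X \<in> ?N \<Longrightarrow> v \<in> X \<Longrightarrow> p X \<in> A v" by blast
  \<comment> \<open>The factor at \<open>v\<close> vanishes iff \<open>x v \<ge> c\<close>, so
    \<open>w X x\<close> is positive just when \<open>X\<close> contains all
    \<open>v \<in> K\<close> with \<open>x v \<ge> c\<close>.\<close>
  define w where "w X x = (\<Prod>v\<in>K - X. max 0 (c - x v))" for X and x :: "'v \<Rightarrow> real"
  define s where "s x = (\<Sum>X\<in>?N. w X x)" for x
  define g where "g x = (\<Sum>X\<in>?N. (w X x / s x) *\<^sub>R p X)" for x
  have w_nonneg: "w X x \<ge> 0" for X x
    unfolding w_def by (intro prod_nonneg) auto
  have s_pos: "s x > 0" if "x \<in> ?R" for x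
  proof -
    have "{v. x v \<noteq> 0} \<in> ?N"
      using that geometric_realization_nerve_iff[OF K] by blast
    \<comment> \<open>Off the support of \<open>x\<close> each factor equals \<open>c\<close>, so
      the support is itself a simplex of positive weight.\<close>
    moreover have "w {v. x v \<noteq> 0} x > 0"
      unfolding w_def using c by (intro prod_pos) auto
    ultimately show ?thesis
      unfolding s_def using finN w_nonneg by (intro sum_pos2) auto
  qed
  have coord: "continuous_on S (\<lambda>x::'v \<Rightarrow> real. x v)" for S v
    by (rule continuous_on_subset[OF continuous_on_product_coordinates subset_UNIV])
  have w_cont: "continuous_on S (w X)" for S X
    unfolding w_def by (intro continuous_intros coord)
  show thesis
  proof (rule that)
    show "continuous_on ?R g"
      unfolding g_def s_def
      using s_pos by (intro continuous_intros w_cont) (auto simp: s_def less_imp_neq[symmetric])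
    fix x v assume x: "x \<in> ?R" and v: "v \<in> K" "x v \<ge> c"
    define M where "M = {X \<in> ?N. v \<in> X}"
    have zero: "w X x = 0" if "X \<in> ?N - M" for X
      unfolding w_def using that v K by (intro prod_zero bexI[of _ v]) (auto simp: M_def)
    \<comment> \<open>Only simplices through \<open>v\<close> contribute, so \<open>g x\<close> is a
      convex combination of points \<open>p X\<close> of \<open>A v\<close>.\<close>
    have "g x = (\<Sum>X\<in>M. (w X x / s x) *\<^sub>R p X)"
      unfolding g_def using finN zero by (intro sum.mono_neutral_right) (auto simp: M_def)
    moreover have "(\<Sum>X\<in>M. w X x) = s x"
      unfolding s_def using finN zero by (intro sum.mono_neutral_left) (auto simp: M_def)
    then have "(\<Sum>X\<in>M. w X x / s x) = 1"
      using s_pos[OF x] by (simp add: sum_divide_distrib[symmetric])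
    moreover have "finite M" using finN by (simp add: M_def)
    ultimately show "g x \<in> A v"
      using s_pos[OF x] w_nonneg p convex[OF v(1)]
      by (auto simp: M_def less_imp_le intro!: convex_sum)
  qed
qed

lemma nerve_homotopy_eqv_union_nonempty:
  fixes A :: "'v \<Rightarrow> 'a::real_normed_vector set"
  assumes K: "finite K" and closed: "\<And>v. v \<in> K \<Longrightarrow> closed (A v)"
    and convex: "\<And>v. v \<in> K \<Longrightarrow> convex (A v)" and ne: "\<And>v. v \<in> K \<Longrightarrow> A v \<noteq> {}"
  shows "geometric_realization (nerve A K) homotopy_eqv (\<Union>v\<in>K. A v)"
proof -
  let ?R = "geometric_realization (nerve A K)" and ?U = "\<Union>v\<in>K. A v"
  define c where "c = 1 / (real (card K) + 1)"
  have c: "c > 0" by (simp add: c_def)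
  note R_iff = geometric_realization_nerve_iff[OF K]
  have large: "\<exists>v\<in>K. x v > c" if "x \<in> ?R" for x
    using geometric_realization_coordinate_gt[OF K that] unfolding c_def by blast
  obtain f :: "'a \<Rightarrow> 'v \<Rightarrow> real" where f: "continuous_on ?U f" "f ` ?U \<subseteq> ?R"
    and f_nz: "\<And>u v. v \<in> K \<Longrightarrow> u \<in> A v \<Longrightarrow> f u v \<noteq> 0"
    and f_max: "\<And>u v w. v \<in> K \<Longrightarrow> u \<in> A v \<Longrightarrow> f u w \<le> f u v"
    using K closed ne by (rule nerve_map_from_union[of K A]) (blast intro: that)+
  obtain g :: "('v \<Rightarrow> real) \<Rightarrow> 'a" where g: "continuous_on ?R g"
    and g_in: "\<And>x v. x \<in> ?R \<Longrightarrow> v \<in> K \<Longrightarrow> x v \<ge> c \<Longrightarrow> g x \<in> A v"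
    using K convex c by (rule nerve_map_to_union[of K A]) (blast intro: that)+
  have gU: "g ` ?R \<subseteq> ?U"
    using large g_in by (fastforce intro: less_imp_le)

  \<comment> \<open>Nothing so far puts the supports of \<open>x\<close> and \<open>f (g x)\<close>
    into one simplex, so the homotopy passes through \<open>\<rho> x\<close>. Its support, the
    coordinates above \<open>c\<close>, is contained in both.\<close>
  define h where "h x v = (if v \<in> K then max 0 (x v - c) else 0)" for x v
  define \<rho> where "\<rho> x v = h x v / sum (h x) K" for x v
  have h_nonneg: "0 \<le> h x v" for x v by (simp add: h_def)
  have h_supp: "{v. h x v \<noteq> 0} = {v\<in>K. x v > c}" for x
    by (auto simp: h_def)
  have h_simplex: "{v. h x v \<noteq> 0} \<in> nerve A K" if x: "x \<in> ?R" for x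
  proof (rule nerve_subset)
    show "{v. x v \<noteq> 0} \<in> nerve A K" using x R_iff by blast
    show "{v. h x v \<noteq> 0} \<subseteq> {v. x v \<noteq> 0}" using c by (auto simp: h_supp)
    show "{v. h x v \<noteq> 0} \<noteq> {}" using large[OF x] by (auto simp: h_supp)
  qed
  note norm = normalize_in_geometric_realization[OF K h_nonneg h_simplex]
  have \<rho>R: "\<rho> ` ?R \<subseteq> ?R"
    using norm(1) unfolding \<rho>_def by blast
  have \<rho>_supp: "{v. \<rho> x v \<noteq> 0} = {v\<in>K. x v > c}" if "x \<in> ?R" for x
    using norm(2)[OF that] unfolding \<rho>_def h_supp .
  have coord: "continuous_on S (\<lambda>x::'v \<Rightarrow> real. x v)" for S v
    by (rule continuous_on_subset[OF continuous_on_product_coordinates subset_UNIV])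
  have h_cont: "continuous_on S (\<lambda>x. h x v)" for S v
    unfolding h_def by (cases "v \<in> K") (simp_all, intro continuous_intros coord)
  have "sum (h x) K \<noteq> 0" if x: "x \<in> ?R" for x
  proof
    assume "sum (h x) K = 0"
    then have "\<forall>v\<in>K. h x v = 0"
      using K h_nonneg by (simp add: sum_nonneg_eq_0_iff)
    with large[OF x] show False by (auto simp: h_def)
  qed
  then have "continuous_on ?R (\<lambda>x. \<rho> x v)" for v
    unfolding \<rho>_def by (intro continuous_intros h_cont) auto
  then have \<rho>: "continuous_on ?R \<rho>"
    by (rule continuous_on_coordinatewise_then_product)

  have gf: "homotopic_with_canon (\<lambda>_. True) ?U ?U (g \<circ> f) id"
  proof (rule homotopic_with_linear)
    show "continuous_on ?U (g \<circ> f)"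
      using f g by (blast intro: continuous_on_compose continuous_on_subset)
    show "continuous_on ?U id" by (rule continuous_on_id')
    fix u assume u: "u \<in> ?U"
    then obtain v where v: "v \<in> K" "u \<in> A v" by blast
    \<comment> \<open>Some coordinate of \<open>f u\<close> exceeds \<open>c\<close>, and the one at
      \<open>v\<close> is at least as large. Hence \<open>g (f u)\<close> and \<open>u\<close> both
      lie in the convex set \<open>A v\<close>.\<close>
    have fu: "f u \<in> ?R" using f u by blast
    then obtain w where "f u w > c" using large by blast
    also have "f u w \<le> f u v" by (rule f_max[OF v])
    finally have "g (f u) \<in> A v" using g_in[OF fu v(1)] by simp
    then show "closed_segment ((g \<circ> f) u) (id u) \<subseteq> ?U"
      using v closed_segment_subset[OF _ v(2) convex[OF v(1)]] by fastforce
  qed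

  have fg_cont: "continuous_on ?R (f \<circ> g)"
    using f g gU by (blast intro: continuous_on_compose continuous_on_subset)
  have fgR: "(f \<circ> g) ` ?R \<subseteq> ?R"
    using f gU by fastforce
  have "homotopic_with_canon (\<lambda>_. True) ?R ?R (f \<circ> g) \<rho>"
  proof (rule homotopic_into_geometric_realization[OF K fg_cont \<rho> fgR \<rho>R])
    fix x assume x: "x \<in> ?R"
    \<comment> \<open>If \<open>x v > c\<close>, then \<open>g x \<in> A v\<close>, and
      \<open>f\<close> has a nonzero coordinate at each member containing its argument.\<close>
    have "{v. \<rho> x v \<noteq> 0} \<subseteq> {v. (f \<circ> g) x v \<noteq> 0}"
      using \<rho>_supp[OF x] f_nz g_in[OF x] by auto
    then have "{v. (f \<circ> g) x v \<noteq> 0} \<union> {v. \<rho> x v \<noteq> 0} = {v. (f \<circ> g) x v \<noteq> 0}" by blast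
    then show "{v. (f \<circ> g) x v \<noteq> 0} \<union> {v. \<rho> x v \<noteq> 0} \<in> nerve A K"
      using fgR x R_iff by (metis image_subset_iff)
  qed
  moreover have "homotopic_with_canon (\<lambda>_. True) ?R ?R \<rho> id"
  proof (rule homotopic_into_geometric_realization[OF K \<rho> continuous_on_id' \<rho>R])
    fix x assume x: "x \<in> ?R"
    have "{v. \<rho> x v \<noteq> 0} \<subseteq> {v. id x v \<noteq> 0}"
      using \<rho>_supp[OF x] c by auto
    then have "{v. \<rho> x v \<noteq> 0} \<union> {v. id x v \<noteq> 0} = {v. x v \<noteq> 0}" by auto
    then show "{v. \<rho> x v \<noteq> 0} \<union> {v. id x v \<noteq> 0} \<in> nerve A K"
      using x R_iff by metis
  qed simp
  ultimately have fg: "homotopic_with_canon (\<lambda>_. True) ?R ?R (f \<circ> g) id"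
    by (rule homotopic_with_trans)

  show ?thesis
    unfolding homotopy_equivalent_space_def
    using f g gU fg gf by (intro exI[of _ g] exI[of _ f]) auto
qed

theorem nerve_homotopy_eqv_union:
  fixes A :: "'v \<Rightarrow> 'a::real_normed_vector set"
  assumes "finite K" "\<And>v. v \<in> K \<Longrightarrow> closed (A v)" "\<And>v. v \<in> K \<Longrightarrow> convex (A v)"
  shows "geometric_realization (nerve A K) homotopy_eqv (\<Union>v\<in>K. A v)"
proof -
  define L where "L = {v\<in>K. A v \<noteq> {}}"
  have nerve: "nerve A K = nerve A L"
    unfolding nerve_def L_def by blast
  have union: "(\<Union>v\<in>K. A v) = (\<Union>v\<in>L. A v)"
    unfolding L_def by blast
  show ?thesis
    unfolding nerve union
    by (rule nerve_homotopy_eqv_union_nonempty) (use assms in \<open>auto simp: L_def\<close>)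
qed

text \<open>The vertices are the complexes themselves, with \<open>Union\<close> giving their point
  sets; distinct complexes covering the same set remain distinct vertices.\<close>

theorem theorem15:
  fixes K :: "plane set set set"
  assumes "finite K"
    and "\<And>\<R>. \<R> \<in> K \<Longrightarrow> vergili_ribbon_complex \<R>"
    and "\<And>\<R>. \<R> \<in> K \<Longrightarrow> closed (\<Union>\<R>)"
    and "\<And>\<R>. \<R> \<in> K \<Longrightarrow> convex (\<Union>\<R>)"
  shows "geometric_realization (nerve Union K) homotopy_eqv (\<Union>\<R>\<in>K. \<Union>\<R>)"
  using assms(1,3,4) by (rule nerve_homotopy_eqv_union)

end
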